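(* Let $\big(g_k\colon \mathbb{R}^d\to\mathbb{R}^d\big)_{k\ge 0}$ be a non-autonomous dynamical system and let $x^\ast\in\mathbb{R}^d$ be an NPH (non-uniformly pseudo-hyperbolic) unstable fixed point of it. Then there exist an open neighborhood $B$ of $x^\ast$, a set $W\subseteq\mathbb{R}^d$ of Lebesgue measure zero, and an integer $K\ge 0$ with the following property: if $(x_k)_{k\ge 0}$ is a sequence in $\mathbb{R}^d$ such that, for some $\bar k\ge K$, we have $x_{k+1}=g_k(x_k)$ and $x_k\in B$ for all $k\ge\bar k$, then $x_k\in W$ for all $k\ge \bar k$.
   Context: A (discrete-time) non-autonomous dynamical system on $\mathbb{R}^d$ is a sequence of maps $(g_k\colon\mathbb{R}^d\to\mathbb{R}^d)_{k\ge0}$ (no regularity assumed a priori). Conventions. $\mathbb{R}^d=E_{\mathrm{cs}}\oplus E_{\mathrm{u}}$ means that $E_{\mathrm{cs}},E_{\mathrm{u}}$ are linear subspaces and each $x\in\mathbb{R}^d$ is uniquely $x=y+z$ with $y\in E_{\mathrm{cs}}$, $z\in E_{\mathrm{u}}$. Given norms on $E_{\mathrm{cs}}$ and $E_{\mathrm{u}}$, the space $\mathbb{R}^d$ is equipped with the max-norm $\|x\|=\max(\|y\|_{E_{\mathrm{cs}}},\|z\|_{E_{\mathrm{u}}})$; $B_r(0)$ is the corresponding open ball. For a map $h$ and a set $U$, $\mathrm{Lip}(h|_U)=\sup_{x\ne y\in U}\|h(x)-h(y)\|/\|x-y\|\in[0,\infty]$. Pseudo-hyperbolicity. Let $g\colon\mathbb{R}^d\to\mathbb{R}^d$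 be a map, $T\colon\mathbb{R}^d\to\mathbb{R}^d$ linear, and $\mu,\lambda,\varepsilon\in\mathbb{R}$ with $1\le\lambda<\mu$, $\varepsilon>0$. Let $U$ be an open neighborhood of $0$. We write $(g,T)\in\mathrm{PH}(\mu,\lambda,\varepsilon;U,E_{\mathrm{cs}}\oplus E_{\mathrm{u}})$ (with respect to specified norms on $E_{\mathrm{cs}},E_{\mathrm{u}}$) if: (1) $g(0)=0$; (2) $T(E_{\mathrm{cs}})\subseteq E_{\mathrm{cs}}$ and $T(E_{\mathrm{u}})\subseteq E_{\mathrm{u}}$; (3) $\|Ty\|\le\lambda\|y\|$ for all $y\in E_{\mathrm{cs}}$ and $\|Tz\|\ge\mu\|z\|$ for all $z\in E_{\mathrm{u}}$; (4) $\mathrm{Lip}((g-T)|_U)\le\varepsilon<(\mu-\lambda)/4$ with respect to the max-norm. NPH unstable fixed point. For $x^\ast\in\mathbb{R}^d$ let $(g_k-x^\ast)$ denote the shifted map $x\mapsto g_k(x+x^\ast)-x^\ast$. A point $x^\ast$ is an NPH unstable fixed point of $(g_k)_{k\ge0}$ if $g_k(x^\ast)=x^\ast$ for all $k\ge 0$ and there exist a splitting $\mathbb{R}^d=E_{\mathrm{cs}}\oplus E_{\mathrm{u}}$ with $\dim E_{\mathrm{u}}\ge1$, norms on $E_{\mathrm{cs}}$ and $E_{\mathrm{u}}$, linear maps $(T_k\colon\mathbb{R}^d\to\mathbb{R}^d)_{k\ge0}$, a radius $r>0$, an index $K\ge0$ and positive constants $(\mu_k,\lambda_k,\varepsilon_k)_{k\ge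 K}$ such that: (a) $(g_k-x^\ast,T_k)\in\mathrm{PH}(\mu_k,\lambda_k,\varepsilon_k/4;B_r(0),E_{\mathrm{cs}}\oplus E_{\mathrm{u}})$ with respect to these same norms for all $k\ge K$; (b) $\varepsilon_k<(\mu_k-\lambda_k)/4$ for all $k\ge K$; (c) $\sum_{k=K}^\infty \varepsilon_k/(\mu_k-2\varepsilon_k)=+\infty$. *)

theory Defs
  imports "HOL-Analysis.Analysis"
begin

definition splitting :: "(real^'n) set \<Rightarrow> (real^'n) set \<Rightarrow> bool" where
  "splitting E F \<longleftrightarrow> subspace E \<and> subspace F \<and> (\<forall>x. \<exists>!p. p \<in> E \<times> F \<and> x = fst p + snd p)"

text \<open>The component in \<open>E\<close> of \<open>x\<close>; meaningful when \<open>splitting E F\<close> (or \<open>splitting F E\<close>) holds.\<close>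

definition component :: "(real^'n) set \<Rightarrow> (real^'n) set \<Rightarrow> real^'n \<Rightarrow> real^'n" where
  "component E F x = (THE y. y \<in> E \<and> (\<exists>z\<in>F. x = y + z))"

text \<open>A norm on a subspace \<open>E\<close> is a function on the whole space of which only the values on \<open>E\<close>
  are constrained.\<close>

definition norm_on :: "(real^'n) set \<Rightarrow> (real^'n \<Rightarrow> real) \<Rightarrow> bool" where
  "norm_on E N \<longleftrightarrow>
     (\<forall>x\<in>E. 0 \<le> N x) \<and>
     (\<forall>x\<in>E. N x = 0 \<longleftrightarrow> x = 0) \<and>
     (\<forall>c. \<forall>x\<in>E. N (c *\<^sub>R x) = \<bar>c\<bar> * N x) \<and>
     (\<forall>x\<in>E. \<forall>y\<in>E. N (x + y) \<le> N x + N y)"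

definition max_norm ::
  "(real^'n) set \<Rightarrow> (real^'n) set \<Rightarrow> (real^'n \<Rightarrow> real) \<Rightarrow> (real^'n \<Rightarrow> real) \<Rightarrow> real^'n \<Rightarrow> real" where
  "max_norm Ecs Eu Ncs Nu x = max (Ncs (component Ecs Eu x)) (Nu (component Eu Ecs x))"

text \<open>The best Lipschitz constant in \<open>[0, \<infinity>]\<close> of \<open>h\<close> on \<open>U\<close> with respect to a norm \<open>N\<close>.
  In \<^typ>\<open>ennreal\<close> the supremum over the empty family is \<open>0\<close>.\<close>

definition Lip_const :: "(real^'n \<Rightarrow> real) \<Rightarrow> (real^'n \<Rightarrow> real^'n) \<Rightarrow> (real^'n) set \<Rightarrow> ennreal" where
  "Lip_const N h U = Sup {ennreal (N (h x - h y) / N (x - y)) | x y. x \<in> U \<and> y \<in> U \<and> x \<noteq> y}"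

text \<open>Pseudo-hyperbolicity, for a given splitting and given norms on the two summands.\<close>

definition PH ::
  "(real^'n) set \<Rightarrow> (real^'n) set \<Rightarrow> (real^'n \<Rightarrow> real) \<Rightarrow> (real^'n \<Rightarrow> real) \<Rightarrow>
   real \<Rightarrow> real \<Rightarrow> real \<Rightarrow> (real^'n) set \<Rightarrow> (real^'n \<Rightarrow> real^'n) \<Rightarrow> (real^'n \<Rightarrow> real^'n) \<Rightarrow> bool" where
  "PH Ecs Eu Ncs Nu \<mu> lam \<epsilon> U g T \<longleftrightarrow>
     linear T \<and> 1 \<le> lam \<and> lam < \<mu> \<and> 0 < \<epsilon> \<and> open U \<and> 0 \<in> U \<and>
     g 0 = 0 \<and>
     T ` Ecs \<subseteq> Ecs \<and> T ` Eu \<subseteq> Eu \<and>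
     (\<forall>y\<in>Ecs. Ncs (T y) \<le> lam * Ncs y) \<and> (\<forall>z\<in>Eu. Nu (T z) \<ge> \<mu> * Nu z) \<and>
     Lip_const (max_norm Ecs Eu Ncs Nu) (\<lambda>x. g x - T x) U \<le> ennreal \<epsilon> \<and> \<epsilon> < (\<mu> - lam) / 4"

definition shifted :: "(real^'n \<Rightarrow> real^'n) \<Rightarrow> real^'n \<Rightarrow> real^'n \<Rightarrow> real^'n" where
  "shifted g xs = (\<lambda>x. g (x + xs) - xs)"

text \<open>Only the values of \<open>\<mu>\<close>, \<open>lam\<close>, \<open>\<epsilon>\<close> at indices \<open>k \<ge> K\<close> matter. The terms of the series are
  positive by the other conditions, so the series has sum \<open>+\<infinity>\<close> iff its partial sums
  tend to \<open>+\<infinity>\<close>.\<close>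

definition NPH_unstable_fixed_point :: "(nat \<Rightarrow> real^'n \<Rightarrow> real^'n) \<Rightarrow> real^'n \<Rightarrow> bool" where
  "NPH_unstable_fixed_point g xs \<longleftrightarrow>
     (\<forall>k. g k xs = xs) \<and>
     (\<exists>Ecs Eu Ncs Nu T r K \<mu> lam \<epsilon>.
        splitting Ecs Eu \<and> 1 \<le> dim Eu \<and>
        norm_on Ecs Ncs \<and> norm_on Eu Nu \<and>
        (\<forall>k. linear (T k)) \<and> 0 < r \<and>
        (\<forall>k\<ge>K. 0 < \<mu> k \<and> 0 < lam k \<and> 0 < \<epsilon> k) \<and>
        (\<forall>k\<ge>K. PH Ecs Eu Ncs Nu (\<mu> k) (lam k) (\<epsilon> k / 4) {x. max_norm Ecs Eu Ncs Nu x < r}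
                  (shifted (g k) xs) (T k)) \<and>
        (\<forall>k\<ge>K. \<epsilon> k < (\<mu> k - lam k) / 4) \<and>
        filterlim (\<lambda>n::nat. \<Sum>k=K..n. \<epsilon> k / (\<mu> k - 2 * \<epsilon> k)) at_top sequentially)"

end

theory Submission
  imports Defs
begin

text \<open>Two orbits that both stay near the fixed point cannot separate in the unstable direction.
  Suppose that at some time the difference of two such orbits lies in the unstable cone, i.e. its
  component in \<open>Eu\<close> is larger than its component in \<open>Ecs\<close>. One step of the system
  keeps the difference in the cone, because the gap between \<open>\<mu>\<close> and \<open>lam\<close> dominates the
  nonlinear part, and it stretches the unstable component by a factor of at least
  \<open>1 + \<epsilon> / (\<mu> - 2 * \<epsilon>)\<close> (\<open>PH_cone_step\<close>). A product of such factors is at least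
  \<open>1\<close> plus the sum of the series in the definition of an NPH unstable fixed point, so it diverges
  (\<open>growth_unbounded\<close>), although the difference of two orbits in a ball of radius \<open>r\<close> never
  exceeds \<open>2 * r\<close>.

  Hence, for each time \<open>k\<close>, any two starting points of trapped orbits differ by a vector outside the
  unstable cone: the starting points form a Lipschitz graph over a subset of
  \<open>Ecs\<close>. As \<open>Ecs\<close> is a proper subspace, such a graph is Lebesgue null
  (\<open>negligible_outside_cone\<close>). The set \<open>W\<close> is the union of these countably many
  graphs.\<close>

section \<open>Splittings and the max-norm\<close>

lemma splitting_sym:
  assumes "splitting E F"
  shows "splitting F E"
proof -
  have "\<exists>!p. p \<in> F \<times> E \<and> x = fst p + snd p" for x
  proof -
    have ex: "\<exists>!p. p \<in> E \<times> F \<and> x = fst p + snd p"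
      using assms by (simp add: splitting_def)
    then obtain p where p: "p \<in> E \<times> F" "x = fst p + snd p" by blast
    show ?thesis
    proof (rule ex1I[of _ "(snd p, fst p)"])
      show "(snd p, fst p) \<in> F \<times> E \<and> x = fst (snd p, fst p) + snd (snd p, fst p)"
        using p by (auto simp: add.commute)
    next
      fix q assume q: "q \<in> F \<times> E \<and> x = fst q + snd q"
      then have "(snd q, fst q) \<in> E \<times> F \<and> x = fst (snd q, fst q) + snd (snd q, fst q)"
        by (auto simp: add.commute)
      then have "(snd q, fst q) = p" using ex p by blast
      then show "q = (snd p, fst p)" by auto
    qed
  qed
  then show ?thesis using assms by (auto simp: splitting_def)
qed

lemma component_add:
  assumes "splitting E F" "y \<in> E" "z \<in> F"
  shows "component E F (y + z) = y"
  unfolding component_def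
proof (rule the_equality)
  fix y' assume "y' \<in> E \<and> (\<exists>z'\<in>F. y + z = y' + z')"
  then obtain z' where z': "y' \<in> E" "z' \<in> F" "y + z = y' + z'" by auto
  have "\<exists>!p. p \<in> E \<times> F \<and> y + z = fst p + snd p"
    using assms(1) by (simp add: splitting_def)
  moreover have "(y, z) \<in> E \<times> F \<and> y + z = fst (y, z) + snd (y, z)"
    using assms by simp
  moreover have "(y', z') \<in> E \<times> F \<and> y + z = fst (y', z') + snd (y', z')"
    using z' by simp
  ultimately have "(y, z) = (y', z')" by blast
  then show "y' = y" by simp
qed (use assms in auto)

lemma splitting_decompose:
  assumes "splitting E F"
  obtains y z where "y \<in> E" "z \<in> F" "x = y + z"
    "component E F x = y" "component F E x = z"
proof -
  obtain p where p: "p \<in> E \<times> F" "x = fst p + snd p"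
    using assms unfolding splitting_def by blast
  then have mem: "fst p \<in> E" "snd p \<in> F" by auto
  show ?thesis
    using that[OF mem p(2)] component_add[OF assms mem]
      component_add[OF splitting_sym[OF assms] mem(2) mem(1)] p(2) by (simp add: add.commute)
qed

lemma component_mem: "splitting E F \<Longrightarrow> component E F x \<in> E"
  by (metis splitting_decompose)

lemma component_sum: "splitting E F \<Longrightarrow> component E F x + component F E x = x"
  by (metis splitting_decompose)

lemma component_invariant:
  assumes "splitting E F" "linear T" "T ` E \<subseteq> E" "T ` F \<subseteq> F"
  shows "component E F (T x) = T (component E F x)"
proof -
  obtain y z where yz: "y \<in> E" "z \<in> F" "x = y + z" "component E F x = y"
    using splitting_decompose[OF assms(1)] by metis
  then have "T x = T y + T z" by (simp add: linear_add assms(2))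
  then show ?thesis using yz assms component_add[OF assms(1), of "T y" "T z"] by auto
qed

lemma component_linear:
  assumes "splitting E F"
  shows "linear (component E F)"
proof (rule linearI)
  have sub: "subspace E" "subspace F" using assms by (auto simp: splitting_def)
  note mem = component_mem[OF assms] component_mem[OF splitting_sym[OF assms]]
  show "component E F (a + b) = component E F a + component E F b" for a b
  proof -
    have "a + b = (component E F a + component E F b) + (component F E a + component F E b)"
      using component_sum[OF assms, of a] component_sum[OF assms, of b]
      by (metis add.assoc add.left_commute)
    then show ?thesis
      using component_add[OF assms] mem subspace_add sub by metis
  qed
  show "component E F (c *\<^sub>R a) = c *\<^sub>R component E F a" for c a
  proof -
    have "c *\<^sub>R a = c *\<^sub>R component E F a + c *\<^sub>R component F E a"
      using component_sum[OF assms, of a] by (metis scaleR_add_right)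
    then show ?thesis
      using component_add[OF assms] mem subspace_scale sub by metis
  qed
qed

lemma norm_on_minus:
  assumes "norm_on E N" "x \<in> E"
  shows "N (- x) = N x"
proof -
  have "N ((-1) *\<^sub>R x) = \<bar>-1\<bar> * N x"
    using assms unfolding norm_on_def by blast
  then show ?thesis by simp
qed

lemma norm_on_diff_triangle:
  assumes "norm_on E N" "subspace E" "x \<in> E" "y \<in> E"
  shows "N x - N y \<le> N (x - y)"
proof -
  have "N ((x - y) + y) \<le> N (x - y) + N y"
    using assms subspace_diff unfolding norm_on_def by blast
  then show ?thesis by simp
qed

lemma max_norm_norm_on:
  assumes sp: "splitting E F" and N: "norm_on E N" "norm_on F M"
  shows "norm_on UNIV (max_norm E F N M)"
proof -
  let ?P = "component E F" and ?Q = "component F E"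
  note spF = splitting_sym[OF sp]
  have PE: "?P x \<in> E" and QF: "?Q x \<in> F" for x
    using component_mem sp spF by auto
  have lin: "linear ?P" "linear ?Q"
    using component_linear sp spF by auto
  have nn: "0 \<le> N (?P x)" "0 \<le> M (?Q x)" for x
    using N PE QF unfolding norm_on_def by auto
  have zero: "N (?P x) = 0 \<longleftrightarrow> ?P x = 0" "M (?Q x) = 0 \<longleftrightarrow> ?Q x = 0" for x
    using N PE QF unfolding norm_on_def by blast+
  have "max (N (?P x)) (M (?Q x)) = 0 \<longleftrightarrow> x = 0" for x
  proof
    assume "max (N (?P x)) (M (?Q x)) = 0"
    then have "N (?P x) = 0" "M (?Q x) = 0" using nn[of x] by linarith+
    then have "?P x = 0" "?Q x = 0" using zero by blast+
    then show "x = 0" using component_sum[OF sp, of x] by simp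
  next
    assume "x = 0"
    then have "N (?P x) = 0" "M (?Q x) = 0"
      using zero linear_0[OF lin(1)] linear_0[OF lin(2)] by blast+
    then show "max (N (?P x)) (M (?Q x)) = 0" by simp
  qed
  moreover have "max (N (?P (c *\<^sub>R x))) (M (?Q (c *\<^sub>R x))) = \<bar>c\<bar> * max (N (?P x)) (M (?Q x))" for c x
  proof -
    have "N (?P (c *\<^sub>R x)) = \<bar>c\<bar> * N (?P x)" "M (?Q (c *\<^sub>R x)) = \<bar>c\<bar> * M (?Q x)"
      using N PE QF linear_scale[OF lin(1)] linear_scale[OF lin(2)]
      unfolding norm_on_def by auto
    then show ?thesis by (simp add: max_mult_distrib_left)
  qed
  moreover have "max (N (?P (x + y))) (M (?Q (x + y)))
      \<le> max (N (?P x)) (M (?Q x)) + max (N (?P y)) (M (?Q y))" for x y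
  proof -
    have "N (?P (x + y)) \<le> N (?P x) + N (?P y)" "M (?Q (x + y)) \<le> M (?Q x) + M (?Q y)"
      using N PE QF linear_add[OF lin(1)] linear_add[OF lin(2)]
      unfolding norm_on_def by auto
    then show ?thesis by linarith
  qed
  ultimately show ?thesis
    unfolding norm_on_def max_norm_def using nn by (simp add: le_max_iff_disj)
qed

lemma norm_on_UNIV_upper:
  fixes m :: "real^'n \<Rightarrow> real"
  assumes m: "norm_on UNIV m"
  obtains C where "C > 0" "\<And>x. m x \<le> C * norm x"
proof -
  have nn: "0 \<le> m x" and sc: "m (c *\<^sub>R x) = \<bar>c\<bar> * m x" and tri: "m (x + y) \<le> m x + m y"
    and zero: "m 0 = 0" for x y c
    using m unfolding norm_on_def by auto
  have sum: "m (\<Sum>i\<in>A. f i) \<le> (\<Sum>i\<in>A. m (f i))" if "finite A"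
    for A and f :: "real^'n \<Rightarrow> real^'n"
    using that by (induction A rule: finite_induct)
      (auto simp: zero intro: order_trans[OF tri])
  have "m x \<le> (\<Sum>b\<in>Basis. m b) * norm x" for x
  proof -
    have "m x = m (\<Sum>b\<in>Basis. (x \<bullet> b) *\<^sub>R b)" by (simp add: euclidean_representation)
    also have "\<dots> \<le> (\<Sum>b\<in>Basis. \<bar>x \<bullet> b\<bar> * m b)" using sum[of Basis "\<lambda>b. (x \<bullet> b) *\<^sub>R b"]
      by (simp add: sc)
    also have "\<dots> \<le> (\<Sum>b\<in>Basis. norm x * m b)"
      by (intro sum_mono mult_right_mono) (auto simp: Basis_le_norm nn)
    finally show ?thesis by (simp add: sum_distrib_left mult.commute)
  qed
  moreover have "(\<Sum>b\<in>Basis. m b) * norm x \<le> ((\<Sum>b\<in>Basis. m b) + 1) * norm x" for x :: "real^'n"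
    by (simp add: mult_right_mono)
  ultimately have "m x \<le> ((\<Sum>b\<in>Basis. m b) + 1) * norm x" for x
    using order_trans by blast
  moreover have "(\<Sum>b\<in>Basis. m b) + 1 > 0"
    by (simp add: sum_nonneg nn add_nonneg_pos)
  ultimately show ?thesis using that by blast
qed

text \<open>The upper bound makes \<open>m\<close> continuous, so \<open>m\<close> attains a positive minimum on the compact
  Euclidean unit sphere, and homogeneity extends the bound to all vectors.\<close>

lemma norm_on_UNIV_lower:
  fixes m :: "real^'n \<Rightarrow> real"
  assumes m: "norm_on UNIV m"
  obtains c where "c > 0" "\<And>x. c * norm x \<le> m x"
proof -
  have nn: "0 \<le> m x" and sc: "m (a *\<^sub>R x) = \<bar>a\<bar> * m x" and zero: "m x = 0 \<longleftrightarrow> x = 0" for x a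
    using m unfolding norm_on_def by auto
  obtain C where C: "C > 0" "\<And>x. m x \<le> C * norm x"
    using norm_on_UNIV_upper[OF m] by blast
  have lip: "\<bar>m x - m y\<bar> \<le> C * norm (x - y)" for x y
  proof -
    have "m x - m y \<le> m (x - y)" "m y - m x \<le> m (y - x)"
      using norm_on_diff_triangle[OF m] by auto
    moreover have "m (y - x) = m (x - y)" using norm_on_minus[OF m, of "x - y"] by simp
    ultimately show ?thesis using C(2)[of "x - y"] by linarith
  qed
  have "C-lipschitz_on (sphere 0 1) m"
    by (rule lipschitz_onI) (use lip C(1) in \<open>auto simp: dist_real_def dist_norm\<close>)
  then have "continuous_on (sphere 0 1) m" by (rule lipschitz_on_continuous_on)
  moreover have "sphere 0 1 \<noteq> ({} :: (real^'n) set)" by simp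
  ultimately have "\<exists>u\<in>sphere 0 1. \<forall>x\<in>sphere 0 1. m u \<le> m x"
    by (intro continuous_attains_inf compact_sphere)
  then obtain u where u: "u \<in> sphere 0 1" "\<And>x. x \<in> sphere 0 1 \<Longrightarrow> m u \<le> m x"
    by blast
  have "u \<noteq> 0" using u(1) by auto
  then have pos: "m u > 0" using nn[of u] zero[of u] by linarith
  moreover have "m u * norm x \<le> m x" for x
  proof (cases "x = 0")
    case False
    then have "m u \<le> m ((1 / norm x) *\<^sub>R x)" by (intro u(2)) simp
    also have "\<dots> = m x / norm x" by (simp only: sc) simp
    finally show ?thesis using False by (simp add: field_simps)
  qed (use nn in simp)
  ultimately show ?thesis using that by blast
qed

section \<open>Lipschitz graphs over proper subspaces are null\<close>

text \<open>The hypothesis says that \<open>P\<close> is injective on \<open>S\<close> with an \<open>L\<close>-Lipschitz inverse. So \<open>S\<close> is a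
  Lipschitz image of a subset of the range of \<open>P\<close>, which is negligible because it is a proper
  subspace. A Lipschitz map into a space of the same dimension preserves negligibility.\<close>

lemma negligible_of_lipschitz_inverse_linear:
  fixes P :: "real^'n \<Rightarrow> real^'n"
  assumes lin: "linear P" and ns: "range P \<noteq> UNIV"
    and L: "\<And>x y. x \<in> S \<Longrightarrow> y \<in> S \<Longrightarrow> norm (x - y) \<le> L * norm (P x - P y)"
  shows "negligible S"
proof -
  have "dim (range P) \<noteq> DIM(real^'n)"
    using ns dim_eq_full[of "range P"] linear_subspace_image[OF lin subspace_UNIV]
    by (metis span_eq_iff)
  then have "dim (range P) < DIM(real^'n)"
    using dim_subset_UNIV[of "range P"] by linarith
  then have "negligible (range P)" by (rule negligible_lowdim)
  then have neg: "negligible (P ` S)" by (rule negligible_subset) auto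
  have inj: "inj_on P S"
  proof (rule inj_onI)
    fix x y assume "x \<in> S" "y \<in> S" "P x = P y"
    then show "x = y" using L[of x y] by simp
  qed
  have "negligible (inv_into S P ` (P ` S))"
  proof (rule negligible_locally_Lipschitz_image[OF order_refl neg])
    fix v assume v: "v \<in> P ` S"
    have "norm (inv_into S P w - inv_into S P v) \<le> L * norm (w - v)" if "w \<in> P ` S" for w
      using L[of "inv_into S P w" "inv_into S P v"] that v
      by (simp add: inv_into_into f_inv_into_f)
    then show "\<exists>T B. open T \<and> v \<in> T \<and>
        (\<forall>w \<in> P ` S \<inter> T. norm (inv_into S P w - inv_into S P v) \<le> B * norm (w - v))"
      by (intro exI[of _ UNIV] exI[of _ L]) auto
  qed
  then show ?thesis by (simp add: inj)
qed

text \<open>Outside the unstable cone the max-norm of a vector is the norm of its \<open>Ecs\<close>-component, so the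
  equivalence of all norms makes the projection to \<open>Ecs\<close> bi-Lipschitz on \<open>S\<close>.\<close>

lemma negligible_outside_cone:
  fixes S :: "(real^'n) set"
  assumes sp: "splitting Ecs Eu" and d: "1 \<le> dim Eu"
    and N: "norm_on Ecs Ncs" "norm_on Eu Nu"
    and cone: "\<And>x y. x \<in> S \<Longrightarrow> y \<in> S \<Longrightarrow>
       Nu (component Eu Ecs (x - y)) \<le> Ncs (component Ecs Eu (x - y))"
  shows "negligible S"
proof -
  let ?P = "component Ecs Eu" and ?Q = "component Eu Ecs" and ?m = "max_norm Ecs Eu Ncs Nu"
  note spu = splitting_sym[OF sp]
  have sub: "subspace Ecs" "subspace Eu" using sp by (auto simp: splitting_def)
  have mn: "norm_on UNIV ?m" by (rule max_norm_norm_on[OF sp N])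
  obtain C where C: "C > 0" "\<And>x. ?m x \<le> C * norm x" using norm_on_UNIV_upper[OF mn] by blast
  obtain c where c: "c > 0" "\<And>x. c * norm x \<le> ?m x" using norm_on_UNIV_lower[OF mn] by blast
  have lin: "linear ?P" by (rule component_linear[OF sp])
  have PP: "?P (?P x) = ?P x" "?Q (?P x) = 0" for x
    using component_add[OF sp component_mem[OF sp] subspace_0[OF sub(2)], of x]
      component_add[OF spu subspace_0[OF sub(2)] component_mem[OF sp], of x] by simp_all
  have "range ?P \<noteq> UNIV"
  proof
    assume full: "range ?P = UNIV"
    have "Eu \<subseteq> {0}"
    proof
      fix z assume z: "z \<in> Eu"
      obtain x where "z = ?P x" using full by (metis rangeE UNIV_I)
      then have "?Q z = 0" using PP by simp
      moreover have "?Q z = z"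
        using component_add[OF spu z subspace_0[OF sub(1)]] by simp
      ultimately show "z \<in> {0}" by simp
    qed
    then have "dim Eu = 0" by (simp add: dim_eq_0)
    then show False using d by linarith
  qed
  moreover have "norm (x - y) \<le> (C / c) * norm (?P x - ?P y)" if "x \<in> S" "y \<in> S" for x y
  proof -
    have "Nu 0 = 0" using N(2) subspace_0[OF sub(2)] unfolding norm_on_def by blast
    moreover have "0 \<le> Ncs (?P (x - y))"
      using N(1) component_mem[OF sp] unfolding norm_on_def by blast
    ultimately have "?m (?P (x - y)) = Ncs (?P (x - y))"
      by (simp add: max_norm_def PP)
    then have "?m (x - y) = ?m (?P (x - y))"
      using cone[OF that] by (simp add: max_norm_def)
    then have "c * norm (x - y) \<le> C * norm (?P (x - y))"
      using c(2)[of "x - y"] C(2)[of "?P (x - y)"] by linarith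
    then show ?thesis using c(1) by (simp add: linear_diff[OF lin] field_simps)
  qed
  ultimately show ?thesis
    by (rule negligible_of_lipschitz_inverse_linear[OF lin])
qed

section \<open>Expansion in the unstable cone\<close>

lemma Lip_const_bound:
  assumes "norm_on UNIV m" "Lip_const m h U \<le> ennreal e" "0 \<le> e" "x \<in> U" "y \<in> U"
  shows "m (h x - h y) \<le> e * m (x - y)"
proof (cases "x = y")
  case True
  moreover have "m 0 = 0" using assms(1) unfolding norm_on_def by blast
  ultimately show ?thesis by simp
next
  case False
  have "m (x - y) \<noteq> 0" "m (x - y) \<ge> 0"
    using False assms(1) unfolding norm_on_def by (simp_all add: right_minus_eq)
  then have pos: "m (x - y) > 0" by linarith
  have "ennreal (m (h x - h y) / m (x - y)) \<le> Lip_const m h U"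
    unfolding Lip_const_def by (rule Sup_upper) (use False assms in blast)
  then have "ennreal (m (h x - h y) / m (x - y)) \<le> ennreal e"
    using assms(2) order_trans by blast
  then have "m (h x - h y) / m (x - y) \<le> e"
    using assms(3) by (simp add: ennreal_le_iff)
  then show ?thesis using pos by (simp add: field_simps)
qed

text \<open>Let \<open>a\<close> be the size of the unstable component of \<open>x - y\<close>. The nonlinear part changes
  each component of the difference by at most \<open>e * a\<close>, so the unstable component of the images is
  at least \<open>(\<mu> - e) * a\<close> and the other one at most \<open>(lam + e) * a\<close>, and \<open>lam + e < \<mu> - e\<close>.\<close>

lemma PH_cone_step:
  assumes ph: "PH Ecs Eu Ncs Nu \<mu> lam e U f T"
    and sp: "splitting Ecs Eu" and N: "norm_on Ecs Ncs" "norm_on Eu Nu"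
    and xy: "x \<in> U" "y \<in> U"
    and cone: "Ncs (component Ecs Eu (x - y)) < Nu (component Eu Ecs (x - y))"
  shows "Ncs (component Ecs Eu (f x - f y)) < Nu (component Eu Ecs (f x - f y))"
    and "(\<mu> - e) * Nu (component Eu Ecs (x - y)) \<le> Nu (component Eu Ecs (f x - f y))"
proof -
  let ?P = "component Ecs Eu" and ?Q = "component Eu Ecs" and ?m = "max_norm Ecs Eu Ncs Nu"
  note spu = splitting_sym[OF sp]
  have sub: "subspace Ecs" "subspace Eu" using sp by (auto simp: splitting_def)
  have T: "linear T" "T ` Ecs \<subseteq> Ecs" "T ` Eu \<subseteq> Eu"
    and Tcs: "\<And>v. v \<in> Ecs \<Longrightarrow> Ncs (T v) \<le> lam * Ncs v"
    and Tu: "\<And>v. v \<in> Eu \<Longrightarrow> \<mu> * Nu v \<le> Nu (T v)"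
    and par: "1 \<le> lam" "0 < e" "e < (\<mu> - lam) / 4"
    and lip: "Lip_const ?m (\<lambda>x. f x - T x) U \<le> ennreal e"
    using ph unfolding PH_def by auto
  define D where "D = f x - f y"
  define h where "h = (f x - T x) - (f y - T y)"
  define a where "a = Nu (?Q (x - y))"
  have D: "D = T (x - y) + h" by (simp add: D_def h_def linear_diff[OF T(1)])
  have linP: "linear ?P" and linQ: "linear ?Q" using component_linear sp spu by auto
  have PE: "?P v \<in> Ecs" and QE: "?Q v \<in> Eu" for v using component_mem sp spu by auto
  have a: "a > 0"
    using cone N(1) PE[of "x - y"] unfolding a_def norm_on_def by (metis order_le_less_trans)
  have "?m h \<le> e * ?m (x - y)"
    using Lip_const_bound[OF max_norm_norm_on[OF sp N] lip _ xy] par by (simp add: h_def)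
  also have "?m (x - y) = a" using cone by (simp add: max_norm_def a_def)
  finally have h: "Ncs (?P h) \<le> e * a" "Nu (?Q h) \<le> e * a"
    by (simp_all add: max_norm_def)
  have "?P D = T (?P (x - y)) + ?P h"
    by (simp add: D linear_add[OF linP] component_invariant[OF sp T])
  moreover have "T (?P (x - y)) \<in> Ecs" using T(2) PE by blast
  ultimately have "Ncs (?P D) \<le> Ncs (T (?P (x - y))) + Ncs (?P h)"
    using N(1) PE unfolding norm_on_def by metis
  also have "\<dots> \<le> lam * a + e * a"
  proof -
    have "lam * Ncs (?P (x - y)) \<le> lam * a" using cone par by (simp add: a_def)
    then show ?thesis using Tcs[OF PE, of "x - y"] h by linarith
  qed
  finally have up: "Ncs (?P D) \<le> (lam + e) * a" by (simp add: algebra_simps)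
  have QD: "?Q D = T (?Q (x - y)) + ?Q h"
    by (simp add: D linear_add[OF linQ] component_invariant[OF spu T(1,3,2)])
  have "Nu (T (?Q (x - y))) - Nu (- ?Q h) \<le> Nu (T (?Q (x - y)) - (- ?Q h))"
    by (rule norm_on_diff_triangle[OF N(2) sub(2)]) (use T(3) QE sub(2) subspace_neg in blast)+
  then have "Nu (T (?Q (x - y))) - Nu (?Q h) \<le> Nu (?Q D)"
    using norm_on_minus[OF N(2) QE] by (simp add: QD)
  moreover have "\<mu> * a \<le> Nu (T (?Q (x - y)))" using Tu QE by (simp add: a_def)
  ultimately have low: "(\<mu> - e) * a \<le> Nu (?Q D)" using h by (simp add: algebra_simps)
  have "(lam + e) * a < (\<mu> - e) * a" using a par by simp
  then show "Ncs (?P (f x - f y)) < Nu (?Q (f x - f y))" using up low by (simp add: D_def)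
  show "(\<mu> - e) * Nu (?Q (x - y)) \<le> Nu (?Q (f x - f y))" using low by (simp add: D_def a_def)
qed

text \<open>A product of factors \<open>1 + a i\<close> with nonnegative \<open>a i\<close> is at least \<open>1\<close> plus the sum of the
  \<open>a i\<close>.\<close>

lemma growth_unbounded:
  fixes d a :: "nat \<Rightarrow> real"
  assumes K: "K \<le> k" and a: "\<And>j. k \<le> j \<Longrightarrow> 0 \<le> a j"
    and step: "\<And>j. k \<le> j \<Longrightarrow> (1 + a j) * d j \<le> d (Suc j)" and pos: "0 < d k"
    and lim: "filterlim (\<lambda>n. \<Sum>i=K..n. a i) at_top sequentially"
  shows "\<exists>n\<ge>k. R < d n"
proof -
  have low: "d k * (1 + (\<Sum>i=k..<n. a i)) \<le> d n" if "k \<le> n" for n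
    using that
  proof (induction n rule: dec_induct)
    case (step n)
    have s: "0 \<le> (\<Sum>i=k..<n. a i)" by (rule sum_nonneg) (use a in auto)
    have "d k \<le> d k * (1 + (\<Sum>i=k..<n. a i))"
      using pos s by (simp add: algebra_simps)
    then have "d k \<le> d n" using step.IH by linarith
    then have "a n * d k \<le> a n * d n" using a step.hyps by (simp add: mult_left_mono)
    then have "d k * (1 + (\<Sum>i=k..<Suc n. a i)) \<le> (1 + a n) * d n"
      using step by (simp add: algebra_simps)
    also have "\<dots> \<le> d (Suc n)" using assms(3) step.hyps(1) .
    finally show ?case .
  qed simp
  have "\<forall>\<^sub>F n in sequentially. (\<Sum>i=K..<k. a i) + \<bar>R\<bar> / d k \<le> (\<Sum>i=K..n. a i)"
    using lim by (simp add: filterlim_at_top)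
  then obtain n where n: "n \<ge> k" "(\<Sum>i=K..<k. a i) + \<bar>R\<bar> / d k \<le> (\<Sum>i=K..n. a i)"
    unfolding eventually_sequentially by (metis nle_le)
  have "(\<Sum>i=K..n. a i) = (\<Sum>i=K..<k. a i) + (\<Sum>i=k..<Suc n. a i)"
    using sum.atLeastLessThan_concat[of K k "Suc n" a] K n(1)
    by (simp add: atLeastLessThanSuc_atLeastAtMost)
  then have "\<bar>R\<bar> / d k \<le> (\<Sum>i=k..<Suc n. a i)" using n(2) by linarith
  then have "\<bar>R\<bar> \<le> d k * (\<Sum>i=k..<Suc n. a i)" using pos by (simp add: field_simps)
  moreover have "d k * (1 + (\<Sum>i=k..<Suc n. a i)) \<le> d (Suc n)"
    by (rule low) (use n(1) in simp)
  ultimately have "R < d (Suc n)" using pos unfolding distrib_left mult_1_right by linarith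
  then show ?thesis using n(1) by (intro exI[of _ "Suc n"]) simp
qed

section \<open>Orbits trapped near the fixed point\<close>

text \<open>Otherwise the unstable component of the difference would grow without bound, whereas the orbits
  stay in a ball.\<close>

lemma trapped_orbits_outside_cone:
  fixes u v :: "nat \<Rightarrow> real^'n"
  assumes sp: "splitting Ecs Eu" and N: "norm_on Ecs Ncs" "norm_on Eu Nu"
    and par: "\<And>k. k \<ge> K \<Longrightarrow> 0 < \<epsilon> k \<and> \<epsilon> k < (\<mu> k - lam k) / 4"
    and ph: "\<And>k. k \<ge> K \<Longrightarrow> PH Ecs Eu Ncs Nu (\<mu> k) (lam k) (\<epsilon> k / 4)
       {x. max_norm Ecs Eu Ncs Nu x < r} (f k) (T k)"
    and lim: "filterlim (\<lambda>n. \<Sum>k=K..n. \<epsilon> k / (\<mu> k - 2 * \<epsilon> k)) at_top sequentially"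
    and k: "K \<le> k"
    and u: "\<And>j. k \<le> j \<Longrightarrow> u (Suc j) = f j (u j) \<and> max_norm Ecs Eu Ncs Nu (u j) < r"
    and v: "\<And>j. k \<le> j \<Longrightarrow> v (Suc j) = f j (v j) \<and> max_norm Ecs Eu Ncs Nu (v j) < r"
  shows "Nu (component Eu Ecs (u k - v k)) \<le> Ncs (component Ecs Eu (u k - v k))"
proof (rule ccontr)
  let ?P = "component Ecs Eu" and ?Q = "component Eu Ecs" and ?m = "max_norm Ecs Eu Ncs Nu"
  assume "\<not> Nu (?Q (u k - v k)) \<le> Ncs (?P (u k - v k))"
  then have start: "Ncs (?P (u k - v k)) < Nu (?Q (u k - v k))" by simp
  define a where "a j = \<epsilon> j / (\<mu> j - 2 * \<epsilon> j)" for j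
  define d where "d j = Nu (?Q (u j - v j))" for j
  note ph_step = PH_cone_step[OF ph sp N]
  have cone: "Ncs (?P (u j - v j)) < Nu (?Q (u j - v j))" if "k \<le> j" for j
    using that
  proof (induction j rule: dec_induct)
    case (step j)
    then show ?case using ph_step(1)[of j "u j" "v j"] u v k by simp
  qed (rule start)
  have pos: "0 < d j" if "k \<le> j" for j
  proof -
    have "0 \<le> Ncs (?P (u j - v j))"
      using N(1) component_mem[OF sp] unfolding norm_on_def by blast
    then show ?thesis using cone[OF that] by (simp add: d_def)
  qed
  have a: "0 \<le> a j" "1 + a j \<le> \<mu> j - \<epsilon> j / 4" if "k \<le> j" for j
  proof -
    have lam: "1 \<le> lam j" using ph[of j] that k unfolding PH_def by simp
    have e: "0 < \<epsilon> j" "\<epsilon> j < (\<mu> j - lam j) / 4" using par that k by auto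
    \<comment> \<open>\<open>\<mu> j\<close> exceeds \<open>1 + 4 * \<epsilon> j\<close>, so the term of the series is at most \<open>\<epsilon> j\<close>.\<close>
    then have m: "1 \<le> \<mu> j - 2 * \<epsilon> j" using lam by simp
    then show "0 \<le> a j" using e by (simp add: a_def)
    have "a j \<le> \<epsilon> j" unfolding a_def
      using m e by (simp add: divide_le_eq)
    then show "1 + a j \<le> \<mu> j - \<epsilon> j / 4" using e lam by simp
  qed
  have step: "(1 + a j) * d j \<le> d (Suc j)" if "k \<le> j" for j
  proof -
    have "(1 + a j) * d j \<le> (\<mu> j - \<epsilon> j / 4) * d j"
      using a pos that by (simp add: mult_right_mono less_imp_le)
    also have "\<dots> \<le> d (Suc j)"
      using ph_step(2)[of j "u j" "v j"] cone u v that k by (simp add: d_def)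
    finally show ?thesis .
  qed
  obtain n where n: "n \<ge> k" "2 * r < d n"
    using growth_unbounded[of K k a d "2 * r"] k a(1) step pos[OF order_refl] lim
    unfolding a_def by blast
  have mn: "norm_on UNIV ?m" by (rule max_norm_norm_on[OF sp N])
  have "d n \<le> ?m (u n - v n)" by (simp add: d_def max_norm_def)
  also have "\<dots> \<le> ?m (u n) + ?m (- v n)"
    using mn unfolding norm_on_def by (metis UNIV_I diff_conv_add_uminus)
  also have "?m (- v n) = ?m (v n)" using norm_on_minus[OF mn] by simp
  finally show False using u v n by force
qed

theorem theorem2p10:
  fixes g :: "nat \<Rightarrow> real^'n \<Rightarrow> real^'n" and xs :: "real^'n"
  assumes "NPH_unstable_fixed_point g xs"
  shows "\<exists>(B :: (real^'n) set) (W :: (real^'n) set) (K :: nat).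
           open B \<and> xs \<in> B \<and> W \<in> null_sets lebesgue \<and>
           (\<forall>(x :: nat \<Rightarrow> real^'n) kbar.
              kbar \<ge> K \<and> (\<forall>k\<ge>kbar. x (Suc k) = g k (x k) \<and> x k \<in> B)
              \<longrightarrow> (\<forall>k\<ge>kbar. x k \<in> W))"
proof -
  obtain Ecs Eu :: "(real^'n) set" and Ncs Nu T r K \<mu> lam \<epsilon> where
    sp: "splitting Ecs Eu" and dim: "1 \<le> dim Eu" and N: "norm_on Ecs Ncs" "norm_on Eu Nu"
    and par: "\<And>k. k \<ge> K \<Longrightarrow> 0 < \<epsilon> k \<and> \<epsilon> k < (\<mu> k - lam k) / 4"
    and ph: "\<And>k. k \<ge> K \<Longrightarrow> PH Ecs Eu Ncs Nu (\<mu> k) (lam k) (\<epsilon> k / 4)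
       {x. max_norm Ecs Eu Ncs Nu x < r} (shifted (g k) xs) (T k)"
    and lim: "filterlim (\<lambda>n::nat. \<Sum>k=K..n. \<epsilon> k / (\<mu> k - 2 * \<epsilon> k)) at_top sequentially"
    using assms unfolding NPH_unstable_fixed_point_def by blast
  let ?U = "{x. max_norm Ecs Eu Ncs Nu x < r}"
  have U: "open ?U" "0 \<in> ?U" using ph[of K] unfolding PH_def by auto
  define B where "B = (+) xs ` ?U"
  have B: "x \<in> B \<longleftrightarrow> max_norm Ecs Eu Ncs Nu (x - xs) < r" for x
    unfolding B_def image_iff by (auto intro!: bexI[of _ "x - xs"])
  define trapped where
    "trapped k x \<longleftrightarrow> (\<forall>j\<ge>k. x (Suc j) = g j (x j) \<and> x j \<in> B)" for k and x :: "nat \<Rightarrow> real^'n"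
  define W where "W k = {x k | x. trapped k x}" for k
  have null: "negligible (W k)" if k: "K \<le> k" for k
  proof (rule negligible_outside_cone[OF sp dim N])
    fix p q assume "p \<in> W k" "q \<in> W k"
    then obtain x y where x: "trapped k x" "p = x k" and y: "trapped k y" "q = y k"
      unfolding W_def by blast
    \<comment> \<open>Differences of orbits do not see the translation that moves \<open>xs\<close> to the origin.\<close>
    have "Nu (component Eu Ecs ((x k - xs) - (y k - xs)))
        \<le> Ncs (component Ecs Eu ((x k - xs) - (y k - xs)))"
      using x(1) y(1)
      by (intro trapped_orbits_outside_cone[OF sp N par ph lim k,
            where u = "\<lambda>j. x j - xs" and v = "\<lambda>j. y j - xs"])
        (auto simp: trapped_def B shifted_def)
    then show "Nu (component Eu Ecs (p - q)) \<le> Ncs (component Ecs Eu (p - q))"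
      by (simp add: x(2) y(2))
  qed
  have "negligible (\<Union>k\<in>{K..}. W k)"
    by (rule negligible_countable_Union) (use null in auto)
  then have W: "(\<Union>k\<in>{K..}. W k) \<in> null_sets lebesgue"
    by (simp add: negligible_iff_null_sets)
  have "open B" unfolding B_def by (rule open_translation[OF U(1)])
  have "xs \<in> B" using U(2) by (simp add: B)
  have hit: "\<forall>x kbar. kbar \<ge> K \<and> (\<forall>k\<ge>kbar. x (Suc k) = g k (x k) \<and> x k \<in> B)
      \<longrightarrow> (\<forall>k\<ge>kbar. x k \<in> (\<Union>k\<in>{K..}. W k))"
  proof (intro allI impI, elim conjE)
    fix x :: "nat \<Rightarrow> real^'n" and kbar k
    assume "kbar \<ge> K" "\<forall>k\<ge>kbar. x (Suc k) = g k (x k) \<and> x k \<in> B" "k \<ge> kbar"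
    then have "trapped k x" "k \<ge> K" unfolding trapped_def by simp_all
    then show "x k \<in> (\<Union>k\<in>{K..}. W k)" unfolding W_def by auto
  qed
  show ?thesis
    by (rule exI[of _ B], rule exI[of _ "\<Union>k\<in>{K..}. W k"], rule exI[of _ K])
      (intro conjI \<open>open B\<close> \<open>xs \<in> B\<close> W hit)
qed

end
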